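(* Let $(A,\vdash,\dashv,\bot,\alpha)$ be a Hom-associative trialgebra. Define new binary operations on $A$ by $$\{x,y\}=x\vdash y-y\dashv x,\qquad [x,y]=x\,\bot\,y-y\,\bot\,x,\qquad x,y\in A.$$ Then $(A,\{\cdot,\cdot\},[\cdot,\cdot],\alpha)$ is a (left) Hom-Leibniz trialgebra.
   Context: All vector spaces are over a field $\mathbb K$ of characteristic $0$. All Hom-algebras are multiplicative, i.e. the twisting map preserves every bilinear operation of the structure. A Hom-associative algebra $(A,\bot,\alpha)$ is a vector space with a bilinear operation $\bot$ and a linear map $\alpha$ such that $(x\,\bot\,y)\,\bot\,\alpha(z)=\alpha(x)\,\bot\,(y\,\bot\,z)$. A Hom-associative dialgebra $(A,\vdash,\dashv,\alpha)$ is a vector space with bilinear operations $\vdash,\dashv$ and a linear map $\alpha$ such that for all $x,y,z$: $(x\dashv y)\vdash\alpha(z)=(x\vdash y)\vdash\alpha(z)$; $\alpha(x)\dashv(y\dashv z)=\alpha(x)\dashv(y\vdash z)$; $(x\dashv y)\dashv\alpha(z)=\alpha(x)\dashv(y\dashv z)$; $(x\vdash y)\vdash\alpha(z)=\alpha(x)\vdash(y\vdash z)$; $(x\vdash y)\dashv\alpha(z)=\alpha(x)\vdash(y\dashv z)$. A Hom-associative trialgebra $(A,\vdash,\dashv,\bot,\alpha)$ consists of a Hom-associative dialgebra $(A,\vdash,\dashv,\alpha)$ and a Hom-associative algebra $(A,\bot,\alpha)$ such that for all $x,y,z\in A$: $(x\dashv y)\dashv\alpha(z)=\alpha(x)\dashv(y\,\bot\,z)$;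 $(x\,\bot\,y)\dashv\alpha(z)=\alpha(x)\,\bot\,(y\dashv z)$; $(x\dashv y)\,\bot\,\alpha(z)=\alpha(x)\,\bot\,(y\vdash z)$; $(x\vdash y)\,\bot\,\alpha(z)=\alpha(x)\vdash(y\,\bot\,z)$; $(x\,\bot\,y)\vdash\alpha(z)=\alpha(x)\vdash(y\vdash z)$. A Hom-Lie algebra $(A,[\cdot,\cdot],\alpha)$ is a vector space with a skew-symmetric bilinear bracket and a linear map $\alpha$ such that $[\alpha(x),[y,z]]+[\alpha(y),[z,x]]+[\alpha(z),[x,y]]=0$. A Hom-Leibniz algebra $(A,\{\cdot,\cdot\},\alpha)$ is a vector space with a bilinear bracket and a linear map $\alpha$ such that $\{\alpha(x),\{y,z\}\}=\{\{x,y\},\alpha(z)\}+\{\alpha(y),\{x,z\}\}$. A (left) Hom-Leibniz trialgebra $(A,\{\cdot,\cdot\},[\cdot,\cdot],\alpha)$ consists of a Hom-Lie algebra $(A,[\cdot,\cdot],\alpha)$ and a Hom-Leibniz algebra $(A,\{\cdot,\cdot\},\alpha)$ such that for all $x,y,z\in A$: $\{\alpha(x),[y,z]\}=[\{x,y\},\alpha(z)]+[\alpha(y),\{x,z\}]$ and $\{[x,y],\alpha(z)\}=\{\{x,y\},\alpha(z)\}$. *)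

theory Defs
  imports Complex_Main
begin

text \<open>
  A vector space is given, as in the library, by a scalar multiplication on an
  additive abelian group type; the algebra is the whole of that type.
\<close>

definition bilinear_operation ::
    "('k::field \<Rightarrow> 'a::ab_group_add \<Rightarrow> 'a) \<Rightarrow> ('a \<Rightarrow> 'a \<Rightarrow> 'a) \<Rightarrow> bool" where
  "bilinear_operation scale m \<longleftrightarrow>
     (\<forall>x. Vector_Spaces.linear scale scale (\<lambda>y. m x y)) \<and>
     (\<forall>y. Vector_Spaces.linear scale scale (\<lambda>x. m x y))"

text \<open>
  The standing conventions are collected here: the ground field has characteristic 0,
  and the twisting map is linear and multiplicative. A structure with several
  operations satisfies this for each of them.
\<close>

locale hom_algebra =
  vector_space scale
  for scale :: "'k::field_char_0 \<Rightarrow> 'a::ab_group_add \<Rightarrow> 'a" +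
  fixes mult :: "'a \<Rightarrow> 'a \<Rightarrow> 'a"
    and \<alpha> :: "'a \<Rightarrow> 'a"
  assumes bilinear_mult: "bilinear_operation scale mult"
    and linear_twist: "Vector_Spaces.linear scale scale \<alpha>"
    and multiplicative: "\<alpha> (mult x y) = mult (\<alpha> x) (\<alpha> y)"

locale hom_associative_algebra =
  hom_algebra scale dot \<alpha>
  for scale :: "'k::field_char_0 \<Rightarrow> 'a::ab_group_add \<Rightarrow> 'a"
    and dot :: "'a \<Rightarrow> 'a \<Rightarrow> 'a"  (infixl "\<bottom>" 70)
    and \<alpha> :: "'a \<Rightarrow> 'a" +
  assumes hom_assoc: "(x \<bottom> y) \<bottom> \<alpha> z = \<alpha> x \<bottom> (y \<bottom> z)"

locale hom_associative_dialgebra =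
  l: hom_algebra scale lprod \<alpha> + r: hom_algebra scale rprod \<alpha>
  for scale :: "'k::field_char_0 \<Rightarrow> 'a::ab_group_add \<Rightarrow> 'a"
    and lprod :: "'a \<Rightarrow> 'a \<Rightarrow> 'a"  (infixl "\<turnstile>" 70)
    and rprod :: "'a \<Rightarrow> 'a \<Rightarrow> 'a"  (infixl "\<stileturn>" 70)
    and \<alpha> :: "'a \<Rightarrow> 'a" +
  assumes bar_left: "(x \<stileturn> y) \<turnstile> \<alpha> z = (x \<turnstile> y) \<turnstile> \<alpha> z"
    and bar_right: "\<alpha> x \<stileturn> (y \<stileturn> z) = \<alpha> x \<stileturn> (y \<turnstile> z)"
    and assoc_right: "(x \<stileturn> y) \<stileturn> \<alpha> z = \<alpha> x \<stileturn> (y \<stileturn> z)"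
    and assoc_left: "(x \<turnstile> y) \<turnstile> \<alpha> z = \<alpha> x \<turnstile> (y \<turnstile> z)"
    and assoc_mixed: "(x \<turnstile> y) \<stileturn> \<alpha> z = \<alpha> x \<turnstile> (y \<stileturn> z)"

locale hom_associative_trialgebra =
  di: hom_associative_dialgebra scale lprod rprod \<alpha> +
  dot: hom_associative_algebra scale dot \<alpha>
  for scale :: "'k::field_char_0 \<Rightarrow> 'a::ab_group_add \<Rightarrow> 'a"
    and lprod :: "'a \<Rightarrow> 'a \<Rightarrow> 'a"  (infixl "\<turnstile>" 70)
    and rprod :: "'a \<Rightarrow> 'a \<Rightarrow> 'a"  (infixl "\<stileturn>" 70)
    and dot :: "'a \<Rightarrow> 'a \<Rightarrow> 'a"  (infixl "\<bottom>" 70)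
    and \<alpha> :: "'a \<Rightarrow> 'a" +
  assumes tri_right_right: "(x \<stileturn> y) \<stileturn> \<alpha> z = \<alpha> x \<stileturn> (y \<bottom> z)"
    and tri_dot_right: "(x \<bottom> y) \<stileturn> \<alpha> z = \<alpha> x \<bottom> (y \<stileturn> z)"
    and tri_right_dot: "(x \<stileturn> y) \<bottom> \<alpha> z = \<alpha> x \<bottom> (y \<turnstile> z)"
    and tri_left_dot: "(x \<turnstile> y) \<bottom> \<alpha> z = \<alpha> x \<turnstile> (y \<bottom> z)"
    and tri_dot_left: "(x \<bottom> y) \<turnstile> \<alpha> z = \<alpha> x \<turnstile> (y \<turnstile> z)"

locale hom_Lie_algebra =
  hom_algebra scale brack \<alpha>
  for scale :: "'k::field_char_0 \<Rightarrow> 'a::ab_group_add \<Rightarrow> 'a"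
    and brack :: "'a \<Rightarrow> 'a \<Rightarrow> 'a"
    and \<alpha> :: "'a \<Rightarrow> 'a" +
  assumes skew_symmetric: "brack x y = - brack y x"
    and hom_Jacobi:
      "brack (\<alpha> x) (brack y z) + brack (\<alpha> y) (brack z x) + brack (\<alpha> z) (brack x y) = 0"

locale hom_Leibniz_algebra =
  hom_algebra scale brace \<alpha>
  for scale :: "'k::field_char_0 \<Rightarrow> 'a::ab_group_add \<Rightarrow> 'a"
    and brace :: "'a \<Rightarrow> 'a \<Rightarrow> 'a"
    and \<alpha> :: "'a \<Rightarrow> 'a" +
  assumes hom_Leibniz:
    "brace (\<alpha> x) (brace y z) = brace (brace x y) (\<alpha> z) + brace (\<alpha> y) (brace x z)"

locale hom_Leibniz_trialgebra =
  Lie: hom_Lie_algebra scale brack \<alpha> +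
  Leibniz: hom_Leibniz_algebra scale brace \<alpha>
  for scale :: "'k::field_char_0 \<Rightarrow> 'a::ab_group_add \<Rightarrow> 'a"
    and brace :: "'a \<Rightarrow> 'a \<Rightarrow> 'a"
    and brack :: "'a \<Rightarrow> 'a \<Rightarrow> 'a"
    and \<alpha> :: "'a \<Rightarrow> 'a" +
  assumes brace_brack:
      "brace (\<alpha> x) (brack y z) = brack (brace x y) (\<alpha> z) + brack (\<alpha> y) (brace x z)"
    and brack_brace: "brace (brack x y) (\<alpha> z) = brace (brace x y) (\<alpha> z)"

end

theory Submission
  imports Defs
begin

text \<open>
  Both brackets are commutators: \<open>{x, y}\<close> is the commutator of a dialgebra, with \<open>\<turnstile>\<close> for
  the product in the given order and \<open>\<stileturn>\<close> for the product in the opposite order, and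
  \<open>[x, y]\<close> is the commutator of \<open>\<bottom>\<close>. Bilinearity and multiplicativity therefore pass
  to both at once, from the case of a twisted commutator \<open>m x y - n y x\<close> of two
  products.

  For the quadratic identities, every trialgebra axiom of associativity type moves a
  product \<open>(x * y) *' \<alpha> z\<close> into the form \<open>\<alpha> x *'' (y *''' z)\<close>. Once the
  brackets are expanded bilinearly, each identity becomes a signed sum of such words, and
  it holds because, up to the axioms, the words cancel. In the hom-Jacobi identity this is the
  classical cancellation for the commutator of an associative product. In the two
  derivation identities, the words where \<open>x\<close> is in the middle cancel: for the
  hom-Leibniz identity through \<open>(y \<stileturn> x) \<turnstile> \<alpha> z = \<alpha> y \<turnstile> (x \<turnstile> z)\<close> (the
  bar axiom) and its mirror image, and for the mixed identity through
  \<open>(y \<stileturn> x) \<bottom> \<alpha> z = \<alpha> y \<bottom> (x \<turnstile> z)\<close>. The last identity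
  expresses that a product in the left argument of \<open>\<turnstile>\<close> or in the right argument of
  \<open>\<stileturn>\<close> (the arguments to which the bar axioms apply) may be any of the three
  products, when the other argument is an \<open>\<alpha> z\<close>.
\<close>

lemma bilinear_operation_diff_left:
  assumes "bilinear_operation scale m"
  shows "m (x - y) z = m x z - m y z"
  using assms unfolding bilinear_operation_def Vector_Spaces.linear_iff_module_hom
  by (metis module_hom.diff)

lemma bilinear_operation_diff_right:
  assumes "bilinear_operation scale m"
  shows "m x (y - z) = m x y - m x z"
  using assms unfolding bilinear_operation_def Vector_Spaces.linear_iff_module_hom
  by (metis module_hom.diff)

lemma bilinear_operation_commutator:
  assumes "vector_space scale" "bilinear_operation scale m" "bilinear_operation scale n"
  shows "bilinear_operation scale (\<lambda>x y. m x y - n y x)"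
proof -
  interpret vector_space_pair scale scale
    using assms(1) by (simp add: vector_space_pair_def)
  show ?thesis
    using assms(2,3) by (simp add: bilinear_operation_def linear_compose_sub)
qed

lemma hom_algebra_commutator:
  assumes "hom_algebra scale m \<alpha>" "hom_algebra scale n \<alpha>"
  shows "hom_algebra scale (\<lambda>x y. m x y - n y x) \<alpha>"
proof -
  interpret m: hom_algebra scale m \<alpha> by fact
  interpret n: hom_algebra scale n \<alpha> by fact
  have twist_diff: "\<alpha> (x - y) = \<alpha> x - \<alpha> y" for x y
    using m.linear_twist
    unfolding Vector_Spaces.linear_iff_module_hom by (rule module_hom.diff)
  show ?thesis
    by (intro hom_algebra.intro hom_algebra_axioms.intro m.vector_space_axioms)
      (simp_all add: twist_diff m.multiplicative n.multiplicative m.linear_twist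
        bilinear_operation_commutator[OF m.vector_space_axioms m.bilinear_mult n.bilinear_mult])
qed

text \<open>
  Each of the six orders of \<open>x\<close>, \<open>y\<close>, \<open>z\<close> occurs in the cyclic sum with both
  signs, once in each of the two bracketings that hom-associativity identifies.
\<close>

lemma (in hom_associative_algebra) hom_Lie_algebra_commutator:
  "hom_Lie_algebra scale (\<lambda>x y. x \<bottom> y - y \<bottom> x) \<alpha>"
proof -
  interpret hom_algebra scale "\<lambda>x y. x \<bottom> y - y \<bottom> x" \<alpha>
    by (rule hom_algebra_commutator; rule hom_algebra_axioms)
  show ?thesis
    by unfold_locales
      (simp_all add: bilinear_operation_diff_left[OF bilinear_mult]
        bilinear_operation_diff_right[OF bilinear_mult] hom_assoc)
qed

text \<open>
  Expanding the right-hand side gives the four words of the left-hand side and four words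
  with \<open>x\<close> between \<open>y\<close> and \<open>z\<close>; the bar axioms make the latter cancel
  in pairs.
\<close>

lemma (in hom_associative_dialgebra) hom_Leibniz_algebra_commutator:
  "hom_Leibniz_algebra scale (\<lambda>x y. x \<turnstile> y - y \<stileturn> x) \<alpha>"
proof -
  interpret hom_algebra scale "\<lambda>x y. x \<turnstile> y - y \<stileturn> x" \<alpha>
    by (rule hom_algebra_commutator; unfold_locales)
  show ?thesis
    by unfold_locales
      (simp add: bilinear_operation_diff_left[OF l.bilinear_mult]
        bilinear_operation_diff_right[OF l.bilinear_mult]
        bilinear_operation_diff_left[OF r.bilinear_mult]
        bilinear_operation_diff_right[OF r.bilinear_mult]
        bar_left bar_right assoc_right assoc_left assoc_mixed)
qed

context hom_associative_trialgebra
begin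

lemmas diff_distribs =
  bilinear_operation_diff_left[OF di.l.bilinear_mult]
  bilinear_operation_diff_right[OF di.l.bilinear_mult]
  bilinear_operation_diff_left[OF di.r.bilinear_mult]
  bilinear_operation_diff_right[OF di.r.bilinear_mult]
  bilinear_operation_diff_left[OF dot.bilinear_mult]
  bilinear_operation_diff_right[OF dot.bilinear_mult]

text \<open>
  The trialgebra axioms send a \<open>\<bottom>\<close> in a bar argument to the same iterated product as the
  dialgebra axioms send a \<open>\<turnstile>\<close> or \<open>\<stileturn>\<close>, so the bar axioms extend to the third
  product.
\<close>

lemma bar_left_dot: "(x \<bottom> y) \<turnstile> \<alpha> z = (x \<turnstile> y) \<turnstile> \<alpha> z"
  by (simp add: tri_dot_left di.assoc_left)

lemma bar_right_dot: "\<alpha> x \<stileturn> (y \<bottom> z) = \<alpha> x \<stileturn> (y \<turnstile> z)"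
  by (simp flip: tri_right_right di.bar_right add: di.assoc_right)

lemma commutator_derivation:
  "(\<alpha> x \<turnstile> (y \<bottom> z - z \<bottom> y) - (y \<bottom> z - z \<bottom> y) \<stileturn> \<alpha> x) =
     ((x \<turnstile> y - y \<stileturn> x) \<bottom> \<alpha> z - \<alpha> z \<bottom> (x \<turnstile> y - y \<stileturn> x)) +
     (\<alpha> y \<bottom> (x \<turnstile> z - z \<stileturn> x) - (x \<turnstile> z - z \<stileturn> x) \<bottom> \<alpha> y)"
  by (simp add: diff_distribs tri_left_dot tri_dot_right tri_right_dot)

lemma commutator_bar:
  "((x \<bottom> y - y \<bottom> x) \<turnstile> \<alpha> z - \<alpha> z \<stileturn> (x \<bottom> y - y \<bottom> x)) =
     ((x \<turnstile> y - y \<stileturn> x) \<turnstile> \<alpha> z - \<alpha> z \<stileturn> (x \<turnstile> y - y \<stileturn> x))"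
  by (simp add: diff_distribs bar_left_dot bar_right_dot di.bar_left di.bar_right)

end

theorem theorem4p21:
  fixes scale :: "'k::field_char_0 \<Rightarrow> 'a::ab_group_add \<Rightarrow> 'a"
    and lprod :: "'a \<Rightarrow> 'a \<Rightarrow> 'a"  (infixl "\<turnstile>" 70)
    and rprod :: "'a \<Rightarrow> 'a \<Rightarrow> 'a"  (infixl "\<stileturn>" 70)
    and dot :: "'a \<Rightarrow> 'a \<Rightarrow> 'a"  (infixl "\<bottom>" 70)
    and \<alpha> :: "'a \<Rightarrow> 'a"
  assumes "hom_associative_trialgebra scale (\<turnstile>) (\<stileturn>) (\<bottom>) \<alpha>"
  shows "hom_Leibniz_trialgebra scale
           (\<lambda>x y. x \<turnstile> y - y \<stileturn> x)
           (\<lambda>x y. x \<bottom> y - y \<bottom> x) \<alpha>"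
proof -
  interpret hom_associative_trialgebra scale "(\<turnstile>)" "(\<stileturn>)" "(\<bottom>)" \<alpha>
    by fact
  show ?thesis
    by (intro hom_Leibniz_trialgebra.intro hom_Leibniz_trialgebra_axioms.intro
        dot.hom_Lie_algebra_commutator di.hom_Leibniz_algebra_commutator
        commutator_derivation commutator_bar)
qed

end
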